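(* Let $n\geq 1$ be an integer. If $\psi\colon\mathbb{N}\to(0,\infty)$ is non-increasing and satisfies $\lim_{s\to\infty}s^{\frac{n+1}{n}}\psi(s)=0$, then $E(\psi)\neq\varnothing$.
   Context: $\mathbb{R}^n$ carries the norm $\|x\|=\max_{1\leq i\leq n}|x_i|$. For a non-increasing $\psi\colon\mathbb{N}\to(0,\infty)$, the set of $\psi$-approximable points is $$W(\psi)=\Big\{x\in\mathbb{R}^n : \text{there exist infinitely many rational points } \tfrac{p}{q}\in\mathbb{Q}^n \text{ with } \big\|x-\tfrac{p}{q}\big\|<\psi(q)\Big\},$$ where $p\in\mathbb{Z}^n$ and $q\geq 1$ is an integer. The set of exact $\psi$-approximable vectors is $$E(\psi)=W(\psi)\setminus\bigcup_{0<c<1}W(c\psi).$$ *)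

theory Defs
  imports "HOL-Analysis.Analysis"
begin

text \<open>
  The space \<open>\<real>\<^sup>n\<close> is the type \<^typ>\<open>real ^ 'n\<close> with \<open>n = CARD('n)\<close>, and the maximum norm on it
  is the library's \<^const>\<open>infnorm\<close>; the lemma below states the coordinate form. The type class
  norm on \<^typ>\<open>real ^ 'n\<close> is Euclidean and is not used.
\<close>

lemma infnorm_eq_Max_abs:
  fixes x :: "real ^ 'n"
  shows "infnorm x = Max (range (\<lambda>i. \<bar>x $ i\<bar>))"
proof -
  have "(\<lambda>b. \<bar>x \<bullet> b\<bar>) ` (Basis :: (real ^ 'n) set) = range (\<lambda>i. \<bar>x $ i\<bar>)"
    by (auto simp: Basis_vec_def inner_axis image_iff)
  then show ?thesis
    by (simp add: infnorm_Max)
qed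

definition rat_point :: "int ^ 'n \<Rightarrow> nat \<Rightarrow> real ^ 'n" where
  "rat_point p q = (\<chi> i. of_int (p $ i) / of_nat q)"

text \<open>
  The set required to be infinite consists of points \<open>p/q\<close> and not of pairs \<open>(p, q)\<close>: a rational
  point counts once, and it counts if one of its representations, not necessarily in lowest
  terms, satisfies the inequality. Denominators start at 1, so the value \<open>\<psi> 0\<close> is irrelevant.
\<close>

definition approximable :: "(nat \<Rightarrow> real) \<Rightarrow> (real ^ 'n) set" where
  "approximable \<psi> =
    {x. infinite {r. \<exists>p q. q \<ge> 1 \<and> r = rat_point p q \<and> infnorm (x - r) < \<psi> q}}"

definition exact_approximable :: "(nat \<Rightarrow> real) \<Rightarrow> (real ^ 'n) set" where
  "exact_approximable \<psi> =
    approximable \<psi> - (\<Union>c\<in>{0<..<1}. approximable (\<lambda>q. c * \<psi> q))"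

end

theory Submission
  imports Defs
begin

text \<open>
  The exact point is the limit of badly approximable points \<open>x\<^sub>k\<close>. Given \<open>x\<^sub>k\<close>, take a best
  approximation \<open>r = p/q\<close> of it with \<open>q\<close> large: rational points of smaller denominator are far
  from \<open>r\<close>. Those in the cube of radius \<open>2 \<psi>(q)\<close> around \<open>r\<close> whose denominators are at most a
  constant times \<open>\<psi>(q)\<close> to the power \<open>-n/(n+1)\<close> lie on one hyperplane, so some vertex of the
  cube of radius \<open>(1 - \<epsilon>/2) \<psi>(q)\<close> around \<open>r\<close> has distance at least this radius from all of
  them. Let \<open>x\<^sub>k\<^sub>+\<^sub>1\<close> be a badly approximable point very close to that vertex, with a constant for
  the remaining denominators that depends only on \<open>\<epsilon>\<close> and \<open>n\<close>; by the decay of \<open>\<psi>\<close> these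
  denominators do no harm either.
\<close>

section \<open>Maximum norm estimates and nested cubes\<close>

lemma infnorm_less_iff_cart:
  fixes x :: "real ^ 'n"
  shows "infnorm x < c \<longleftrightarrow> (\<forall>i. \<bar>x $ i\<bar> < c)"
  by (simp add: infnorm_eq_Max_abs)

lemma infnorm_diff_triangle_ineq:
  fixes x y z :: "'a::euclidean_space"
  shows "infnorm (x - z) \<le> infnorm (x - y) + infnorm (y - z)"
  using infnorm_triangle[of "x - y" "y - z"] by simp

lemma abs_sum_mult_le_infnorm:
  fixes x m :: "real ^ 'n"
  shows "\<bar>\<Sum>i\<in>UNIV. m $ i * x $ i\<bar> \<le> (\<Sum>i\<in>UNIV. \<bar>m $ i\<bar>) * infnorm x"
proof -
  have "\<bar>\<Sum>i\<in>UNIV. m $ i * x $ i\<bar> \<le> (\<Sum>i\<in>UNIV. \<bar>m $ i\<bar> * infnorm x)"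
    by (rule order_trans[OF sum_abs])
      (auto intro!: sum_mono mult_left_mono simp: abs_mult component_le_infnorm_cart)
  then show ?thesis by (simp add: sum_distrib_right)
qed

text \<open>By the triangle inequality the closed cubes are nested, and they are compact because
  \<open>norm\<close> is at most \<open>sqrt DIM('a)\<close> times \<open>infnorm\<close>.\<close>

lemma nested_infnorm_balls:
  fixes y :: "nat \<Rightarrow> 'a::euclidean_space" and \<rho> :: "nat \<Rightarrow> real"
  assumes pos: "\<And>k. 0 \<le> \<rho> k"
    and step: "\<And>k. infnorm (y (Suc k) - y k) + \<rho> (Suc k) \<le> \<rho> k"
  obtains x where "\<And>k. infnorm (x - y k) \<le> \<rho> k"
proof -
  define S where "S k = {x. infnorm (x - y k) \<le> \<rho> k}" for k
  have sub: "S (Suc k) \<subseteq> S k" for k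
  proof
    fix x assume "x \<in> S (Suc k)"
    then show "x \<in> S k"
      using step[of k] infnorm_diff_triangle_ineq[of x "y k" "y (Suc k)"] by (simp add: S_def)
  qed
  show ?thesis
  proof (rule bounded_closed_nest[of S])
    show "closed (S n)" for n
      unfolding S_def by (auto intro!: closed_Collect_le continuous_intros)
    show "S n \<noteq> {}" for n
      using pos[of n] by (auto simp: S_def infnorm_0 intro: exI[of _ "y n"])
    show "S n \<subseteq> S m" if "m \<le> n" for m n
      using lift_Suc_antimono_le[of S, OF sub that] .
    have "norm (x - y 0) \<le> sqrt DIM('a) * \<rho> 0" if "x \<in> S 0" for x
      using that norm_le_infnorm[of "x - y 0"] unfolding S_def
      by (smt (verit) mem_Collect_eq mult_left_mono real_sqrt_ge_zero of_nat_0_le_iff)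
    then show "bounded (S 0)"
      by (intro bounded_subset[OF bounded_cball[of "y 0" "sqrt DIM('a) * \<rho> 0"]])
        (auto simp: dist_norm norm_minus_commute)
  next
    fix x assume "\<And>k. x \<in> S k"
    then show ?thesis by (intro that) (simp add: S_def)
  qed
qed

section \<open>The dual Dirichlet theorem and vertices far from a hyperplane\<close>

text \<open>Pigeonhole, with \<open>n = CARD('n)\<close>: the \<open>(A + 1)^n\<close> vectors with
  entries in \<open>{0..A}\<close> have values of the form modulo 1 in only \<open>A^n\<close>
  intervals of length \<open>1 / A^n\<close>; the difference of two vectors that share an interval
  gives \<open>m\<close>.\<close>

lemma dual_Dirichlet_approx:
  fixes y :: "real ^ 'n" and A :: nat
  assumes "A \<ge> 1"
  obtains m :: "int ^ 'n" and b :: int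
  where "m \<noteq> 0" "\<And>i. \<bar>m $ i\<bar> \<le> int A"
    "\<bar>of_int b + (\<Sum>i\<in>UNIV. of_int (m $ i) * y $ i)\<bar> < 1 / real A ^ CARD('n)"
proof -
  define D where "D = PiE (UNIV :: 'n set) (\<lambda>_. {0..int A})"
  define F where "F f = (\<Sum>i\<in>UNIV. of_int (f i) * y $ i)" for f :: "'n \<Rightarrow> int"
  define K where "K = real A ^ CARD('n)"
  define \<phi> where "\<phi> f = \<lfloor>K * frac (F f)\<rfloor>" for f
  have K: "K > 0" using assms by (simp add: K_def)
  have "\<phi> f \<in> {0..<int (A ^ CARD('n))}" for f
  proof -
    have "K * frac (F f) < K" using K frac_lt_1[of "F f"] by simp
    moreover have "0 \<le> K * frac (F f)" using K by simp
    moreover have "K = of_int (int (A ^ CARD('n)))" by (simp add: K_def)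
    ultimately show ?thesis by (auto simp: \<phi>_def floor_less_iff le_floor_iff)
  qed
  then have "card (\<phi> ` D) \<le> card {0..<int (A ^ CARD('n))}"
    by (intro card_mono) auto
  also have "\<dots> = A ^ CARD('n)" by (simp only: card_atLeastLessThan_int diff_zero nat_int)
  also have "\<dots> < Suc A ^ CARD('n)" by (intro power_strict_mono) auto
  also have "\<dots> = card D" by (simp add: D_def card_PiE nat_add_distrib)
  finally have "\<not> inj_on \<phi> D" by (rule pigeonhole)
  then obtain f g where fg: "f \<in> D" "g \<in> D" "f \<noteq> g" "\<phi> f = \<phi> g"
    by (auto simp: inj_on_def)
  have "\<bar>K * frac (F f) - K * frac (F g)\<bar> < 1"
    using fg(4) unfolding \<phi>_def by linarith
  also have "\<bar>K * frac (F f) - K * frac (F g)\<bar> = K * \<bar>frac (F f) - frac (F g)\<bar>"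
    using K by (simp add: abs_mult flip: right_diff_distrib)
  finally have less: "\<bar>frac (F f) - frac (F g)\<bar> < 1 / K"
    using K by (simp add: field_simps)
  define m where "m = (\<chi> i. f i - g i)"
  define b where "b = \<lfloor>F g\<rfloor> - \<lfloor>F f\<rfloor>"
  have "(\<Sum>i\<in>UNIV. of_int (m $ i) * y $ i) = F f - F g"
    by (simp add: m_def F_def left_diff_distrib sum_subtractf)
  then have "of_int b + (\<Sum>i\<in>UNIV. of_int (m $ i) * y $ i) = frac (F f) - frac (F g)"
    by (simp add: b_def frac_def)
  with less have "\<bar>of_int b + (\<Sum>i\<in>UNIV. of_int (m $ i) * y $ i)\<bar> < 1 / real A ^ CARD('n)"
    by (simp add: K_def)
  moreover have "m \<noteq> 0"
    using fg(3) by (auto simp: m_def vec_eq_iff fun_eq_iff)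
  moreover have "\<bar>m $ i\<bar> \<le> int A" for i
  proof -
    have "f i \<in> {0..int A}" "g i \<in> {0..int A}" using fg(1,2) by (auto simp: D_def PiE_def Pi_def)
    then show ?thesis by (auto simp: m_def)
  qed
  ultimately show ?thesis using that by blast
qed

text \<open>The l1 norm \<open>M\<close> of \<open>m\<close> is dual to the maximum norm. Moving
  from \<open>y\<close> to a suitable vertex of the cube of radius \<open>t\<close> changes the form
  by the full amount \<open>M * t\<close>, away from 0; getting back to a zero of the form takes a
  move of length at least \<open>t\<close>.\<close>

lemma vertex_away_from_hyperplane:
  fixes m y :: "real ^ 'n" and b t :: real
  assumes "m \<noteq> 0" "t \<ge> 0"
  obtains w where "infnorm (w - y) = t"
    "\<And>z. b + (\<Sum>i\<in>UNIV. m $ i * z $ i) = 0 \<Longrightarrow> t \<le> infnorm (w - z)"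
proof -
  define h where "h z = b + (\<Sum>i\<in>UNIV. m $ i * z $ i)" for z :: "real ^ 'n"
  define M where "M = (\<Sum>i\<in>UNIV. \<bar>m $ i\<bar>)"
  define s :: real where "s = (if h y \<ge> 0 then 1 else -1)"
  define v :: "real ^ 'n" where "v = (\<chi> i. if m $ i \<ge> 0 then s * t else - (s * t))"
  have abs_s: "\<bar>s\<bar> = 1" by (simp add: s_def)
  have M: "M > 0"
  proof -
    obtain i where "m $ i \<noteq> 0" using assms(1) by (auto simp: vec_eq_iff)
    then show ?thesis unfolding M_def by (intro sum_pos2[of _ i]) auto
  qed
  have diff: "h z - h z' = (\<Sum>i\<in>UNIV. m $ i * (z - z') $ i)" for z z'
    by (simp add: h_def right_diff_distrib sum_subtractf)
  have "\<bar>v $ i\<bar> = t" for i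
    using assms(2) abs_s by (auto simp: v_def abs_mult)
  then have v: "infnorm v = t" by (simp add: infnorm_eq_Max_abs)
  have "h (y + v) - h y = (\<Sum>i\<in>UNIV. m $ i * v $ i)" by (simp add: diff)
  also have "\<dots> = (\<Sum>i\<in>UNIV. \<bar>m $ i\<bar> * (s * t))" by (intro sum.cong) (auto simp: v_def)
  also have "\<dots> = s * (M * t)" by (simp add: M_def sum_distrib_left sum_distrib_right mult_ac)
  finally have "h (y + v) = h y + s * (M * t)" by simp
  moreover have "0 \<le> M * t" using M assms(2) by simp
  ultimately have hv: "M * t \<le> \<bar>h (y + v)\<bar>" by (auto simp: s_def)
  have "t \<le> infnorm ((y + v) - z)" if "h z = 0" for z
  proof -
    have "M * t \<le> \<bar>h (y + v) - h z\<bar>" using hv that by simp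
    also have "\<dots> \<le> M * infnorm ((y + v) - z)"
      unfolding diff M_def by (rule abs_sum_mult_le_infnorm)
    finally show ?thesis using M by simp
  qed
  then show ?thesis using v by (intro that[of "y + v"]) (auto simp: h_def)
qed

lemma infnorm_diff_rat_point:
  fixes p :: "int ^ 'n"
  assumes "q \<ge> 1"
  shows "infnorm (x - rat_point p q) = infnorm (real q *\<^sub>R x - (\<chi> i. of_int (p $ i))) / real q"
proof -
  have "real q *\<^sub>R x - (\<chi> i. of_int (p $ i)) = real q *\<^sub>R (x - rat_point p q)"
    using assms by (auto simp: vec_eq_iff rat_point_def field_simps)
  then show ?thesis using assms by (simp add: infnorm_mul)
qed

text \<open>
  This replaces the simplex lemma: by the dual Dirichlet theorem, the rational points in a small
  cube with denominators up to the scale of the cube all lie on one hyperplane, because an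
  integer linear form takes values of modulus less than 1 on them.
\<close>

lemma vertex_away_from_rationals:
  obtains \<kappa> :: real where "\<kappa> > 0"
    "\<And>y \<rho> t. \<lbrakk>\<rho> > 0; t \<ge> 0\<rbrakk> \<Longrightarrow> \<exists>w :: real ^ 'n. infnorm (w - y) = t \<and>
      (\<forall>p q. q \<ge> 1 \<longrightarrow> \<rho> * real q powr (1 + 1 / CARD('n)) \<le> \<kappa> \<longrightarrow>
        infnorm (rat_point p q - y) \<le> \<rho> \<longrightarrow> t \<le> infnorm (w - rat_point p q))"
proof
  define n where "n = real CARD('n)"
  have n: "n \<ge> 1" by (simp add: n_def Suc_le_eq)
  show "1 / (8 * n) > 0" using n by simp
  fix y :: "real ^ 'n" and \<rho> t :: real
  assume \<rho>: "\<rho> > 0" and t: "t \<ge> 0"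
  \<comment> \<open>This value makes the final bound \<open>1 / 2 + 4 * n * \<kappa>\<close> equal
    to 1. The solution \<open>Q\<close> of \<open>\<rho> * Q powr (1 + 1 / n) = \<kappa>\<close> is
    the bound for the denominators to be avoided.\<close>
  define \<kappa> where "\<kappa> = 1 / (8 * n)"
  define Q where "Q = (\<kappa> / \<rho>) powr (1 / (1 + 1 / n))"
  have \<kappa>: "\<kappa> > 0" using n by (simp add: \<kappa>_def)
  have Q: "Q > 0" using \<kappa> \<rho> by (simp add: Q_def)
  have Q_powr: "\<rho> * Q powr (1 + 1 / n) = \<kappa>"
  proof -
    have "1 + 1 / n \<noteq> 0" using n by (smt (verit) divide_nonneg_pos)
    then show ?thesis using \<rho> \<kappa> by (simp add: Q_def powr_powr)
  qed
  have q_le: "real q \<le> Q" if "\<rho> * real q powr (1 + 1 / n) \<le> \<kappa>" for q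
  proof (rule ccontr)
    assume "\<not> real q \<le> Q"
    then have "Q powr (1 + 1 / n) < real q powr (1 + 1 / n)"
      using Q n by (intro powr_less_mono2) (auto simp: add_pos_pos)
    then show False using that Q_powr \<rho> by (smt (verit) mult_strict_left_mono)
  qed
  show "\<exists>w :: real ^ 'n. infnorm (w - y) = t \<and>
      (\<forall>p q. q \<ge> 1 \<longrightarrow> \<rho> * real q powr (1 + 1 / CARD('n)) \<le> 1 / (8 * n) \<longrightarrow>
        infnorm (rat_point p q - y) \<le> \<rho> \<longrightarrow> t \<le> infnorm (w - rat_point p q))"
  proof (cases "Q \<ge> 1")
    \<comment> \<open>No denominator is admissible here, so any vertex serves.\<close>
    case False
    have "infnorm (y + t *\<^sub>R (\<chi> i. 1) - y) = t"
      using t by (simp add: infnorm_mul) (simp add: infnorm_eq_Max_abs)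
    moreover have "\<not> \<rho> * real q powr (1 + 1 / n) \<le> \<kappa>" if "q \<ge> 1" for q
      using q_le[of q] that False by fastforce
    ultimately show ?thesis unfolding n_def \<kappa>_def by blast
  next
    case True
    \<comment> \<open>\<open>A\<close> is large enough for \<open>2 * Q \<le> A^n\<close>, so that
      the error of the form at \<open>y\<close>, multiplied by \<open>q\<close>, contributes at most
      1/2; the bound \<open>A \<le> 4 * Q powr (1 / n)\<close> controls the variation of the form
      over the cube.\<close>
    define A where "A = nat \<lceil>(2 * Q) powr (1 / n)\<rceil>"
    have ge1: "(2 * Q) powr (1 / n) \<ge> 1" using True n by (intro ge_one_powr_ge_zero) auto
    have A_ge: "real A \<ge> (2 * Q) powr (1 / n)" by (simp add: A_def)
    have "real A \<le> (2 * Q) powr (1 / n) + 1" using ge1 unfolding A_def by linarith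
    also have "\<dots> \<le> 2 * (2 powr (1 / n) * Q powr (1 / n))"
      using ge1 Q by (simp add: powr_mult mult_ac)
    also have "\<dots> \<le> 2 * (2 powr 1 * Q powr (1 / n))"
      using n by (intro mult_left_mono mult_right_mono powr_mono) auto
    finally have A_le: "real A \<le> 4 * Q powr (1 / n)" by simp
    have "2 * Q = ((2 * Q) powr (1 / n)) ^ CARD('n)"
      using Q n by (simp add: n_def powr_powr flip: powr_realpow)
    also have "\<dots> \<le> real A ^ CARD('n)" using A_ge by (intro power_mono) auto
    finally have A_pow: "2 * Q \<le> real A ^ CARD('n)" .
    have "A \<ge> 1" using A_ge ge1 by linarith
    then obtain m :: "int ^ 'n" and b :: int
      where m: "m \<noteq> 0" "\<And>i. \<bar>m $ i\<bar> \<le> int A"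
        and b: "\<bar>of_int b + (\<Sum>i\<in>UNIV. of_int (m $ i) * y $ i)\<bar> < 1 / real A ^ CARD('n)"
      using dual_Dirichlet_approx[of A y] by blast
    define m' :: "real ^ 'n" where "m' = (\<chi> i. of_int (m $ i))"
    have m': "m' \<noteq> 0" using m(1) by (auto simp: m'_def vec_eq_iff)
    have sum_m': "(\<Sum>i\<in>UNIV. \<bar>m' $ i\<bar>) \<le> n * real A"
    proof -
      have "\<bar>m' $ i\<bar> \<le> real A" for i using m(2)[of i] by (simp add: m'_def flip: of_int_abs)
      then have "(\<Sum>i\<in>UNIV. \<bar>m' $ i\<bar>) \<le> (\<Sum>i\<in>(UNIV :: 'n set). real A)" by (intro sum_mono)
      then show ?thesis by (simp add: n_def)
    qed
    have hyper: "of_int b + (\<Sum>i\<in>UNIV. m' $ i * rat_point p q $ i) = 0"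
      if q: "q \<ge> 1" "\<rho> * real q powr (1 + 1 / n) \<le> \<kappa>" and near: "infnorm (rat_point p q - y) \<le> \<rho>" for p q
    proof -
      let ?r = "rat_point p q"
      let ?h = "of_int b + (\<Sum>i\<in>UNIV. m' $ i * ?r $ i)"
      define k where "k = int q * b + (\<Sum>i\<in>UNIV. m $ i * p $ i)"
      have k: "of_int k = real q * ?h"
        using q(1) by (simp add: k_def m'_def rat_point_def distrib_left sum_distrib_left)
      have "?h = (of_int b + (\<Sum>i\<in>UNIV. of_int (m $ i) * y $ i)) + (\<Sum>i\<in>UNIV. m' $ i * (?r - y) $ i)"
        by (simp add: m'_def right_diff_distrib sum_subtractf)
      then have "\<bar>?h\<bar> < 1 / real A ^ CARD('n) + (\<Sum>i\<in>UNIV. \<bar>m' $ i\<bar>) * infnorm (?r - y)"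
        using b abs_sum_mult_le_infnorm[of m' "?r - y"] by linarith
      also have "\<dots> \<le> 1 / (2 * Q) + (n * (4 * Q powr (1 / n))) * \<rho>"
      proof (intro add_mono mult_mono)
        show "1 / real A ^ CARD('n) \<le> 1 / (2 * Q)" using A_pow Q \<open>A \<ge> 1\<close> by (intro divide_left_mono mult_pos_pos) auto
        show "(\<Sum>i\<in>UNIV. \<bar>m' $ i\<bar>) \<le> n * (4 * Q powr (1 / n))"
          using sum_m' A_le n by (smt (verit) mult_left_mono)
      qed (use near n infnorm_pos_le in auto)
      finally have less: "\<bar>?h\<bar> < 1 / (2 * Q) + 4 * n * \<rho> * Q powr (1 / n)" by (simp add: mult_ac)
      have "\<bar>real_of_int k\<bar> = real q * \<bar>?h\<bar>" by (simp add: k abs_mult)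
      also have "\<dots> \<le> Q * \<bar>?h\<bar>" using q_le[OF q(2)] by (intro mult_right_mono) auto
      also have "\<dots> < Q * (1 / (2 * Q) + 4 * n * \<rho> * Q powr (1 / n))"
        using less Q by simp
      also have "\<dots> = 1 / 2 + 4 * n * (\<rho> * Q powr (1 + 1 / n))"
        using Q by (simp add: powr_add distrib_left)
      also have "\<dots> = 1" unfolding Q_powr using n by (simp add: \<kappa>_def)
      finally have "k = 0" by linarith
      then show ?thesis using k q(1) by simp
    qed
    obtain w where w: "infnorm (w - y) = t"
      "\<And>z. of_int b + (\<Sum>i\<in>UNIV. m' $ i * z $ i) = 0 \<Longrightarrow> t \<le> infnorm (w - z)"
      using vertex_away_from_hyperplane[OF m' t, of y "of_int b"] by blast
    show ?thesis
      using w hyper unfolding n_def \<kappa>_def by blast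
  qed
qed

section \<open>Badly approximable points in every cube\<close>

text \<open>The usual condition on the distance of \<open>q * x\<close> from the integer points,
  divided by \<open>q\<close>; hence the exponent \<open>1 + 1 / n\<close> instead of
  \<open>1 / n\<close>.\<close>

definition badly_approximable :: "real ^ 'n \<Rightarrow> bool" where
  "badly_approximable x \<longleftrightarrow> (\<exists>c>0. \<forall>p q. q \<ge> 1 \<longrightarrow>
    c / real q powr (1 + 1 / CARD('n)) \<le> infnorm (x - rat_point p q))"

lemma badly_approximableI:
  fixes x :: "real ^ 'n"
  assumes "\<eta> > 0" "c > 0"
    and "\<And>p q. q \<ge> 1 \<Longrightarrow> min \<eta> (c / real q powr (1 + 1 / CARD('n))) \<le> infnorm (x - rat_point p q)"
  shows "badly_approximable x"
  unfolding badly_approximable_def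
proof (intro exI[of _ "min \<eta> c"] conjI allI impI)
  show "min \<eta> c > 0" using assms by simp
  fix p :: "int ^ 'n" and q :: nat
  assume q: "1 \<le> q"
  let ?u = "real q powr (1 + 1 / CARD('n))"
  have "?u \<ge> 1" using q by (intro ge_one_powr_ge_zero) auto
  then have "min \<eta> c / ?u \<le> min \<eta> c / 1"
    using assms(1,2) q by (intro divide_left_mono) auto
  moreover have "min \<eta> c / ?u \<le> c / ?u"
    by (intro divide_right_mono) auto
  ultimately show "min \<eta> c / ?u \<le> infnorm (x - rat_point p q)"
    using assms(3)[OF q, of p] unfolding div_by_1 by linarith
qed

text \<open>Repeated choice of vertices in nested cubes of radius \<open>\<rho> / 4^k\<close>, each
  avoiding the denominators up to the scale of its cube. That \<open>c\<close> is the same for all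
  cubes is essential in \<open>exact_step\<close>; the cap \<open>\<rho> / 4\<close> accounts for
  the denominators handled already in the first cube.\<close>

lemma badly_approximable_in_ball:
  obtains c :: real where "c > 0"
    "\<And>y \<rho>. \<rho> > 0 \<Longrightarrow> \<exists>x :: real ^ 'n. infnorm (x - y) \<le> \<rho> \<and>
      (\<forall>p q. q \<ge> 1 \<longrightarrow> min (\<rho> / 4) (c / real q powr (1 + 1 / CARD('n))) \<le> infnorm (x - rat_point p q))"
proof -
  obtain \<kappa> :: real where \<kappa>: "\<kappa> > 0"
    and vertex: "\<And>y \<rho> t. \<lbrakk>\<rho> > 0; t \<ge> 0\<rbrakk> \<Longrightarrow> \<exists>w :: real ^ 'n. infnorm (w - y) = t \<and>
      (\<forall>p q. q \<ge> 1 \<longrightarrow> \<rho> * real q powr (1 + 1 / CARD('n)) \<le> \<kappa> \<longrightarrow>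
        infnorm (rat_point p q - y) \<le> \<rho> \<longrightarrow> t \<le> infnorm (w - rat_point p q))"
    using vertex_away_from_rationals[where 'n = 'n] by blast
  have "\<exists>x :: real ^ 'n. infnorm (x - y) \<le> \<rho> \<and>
      (\<forall>p q. q \<ge> 1 \<longrightarrow> min (\<rho> / 4) (\<kappa> / 32 / real q powr (1 + 1 / CARD('n))) \<le> infnorm (x - rat_point p q))"
    if \<rho>: "\<rho> > 0" for y and \<rho> :: real
  proof -
    \<comment> \<open>The ratio 4 serves two purposes: after a move by \<open>R k / 2\<close> the
      next cube still fits into the current one, and the later drift of at most
      \<open>R k / 4\<close> leaves half of the distance \<open>R k / 2\<close> won by the
      move.\<close>
    define R where "R k = \<rho> / 4 ^ k" for k :: nat
    have R: "R k > 0" "R (Suc k) = R k / 4" for k using \<rho> by (simp_all add: R_def)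
    have "\<exists>w :: real ^ 'n. infnorm (w - z) = R k / 2 \<and>
      (\<forall>p q. q \<ge> 1 \<longrightarrow> 2 * R k * real q powr (1 + 1 / CARD('n)) \<le> \<kappa> \<longrightarrow>
        infnorm (rat_point p q - z) \<le> 2 * R k \<longrightarrow> R k / 2 \<le> infnorm (w - rat_point p q))" for z k
      using vertex[of "2 * R k" "R k / 2" z] R(1)[of k] by simp
    then obtain W :: "real ^ 'n \<Rightarrow> nat \<Rightarrow> real ^ 'n" where W: "\<And>z k. infnorm (W z k - z) = R k / 2"
      "\<And>z k p q. \<lbrakk>q \<ge> 1; 2 * R k * real q powr (1 + 1 / CARD('n)) \<le> \<kappa>;
        infnorm (rat_point p q - z) \<le> 2 * R k\<rbrakk> \<Longrightarrow> R k / 2 \<le> infnorm (W z k - rat_point p q)"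
      by metis
    define Y where "Y = rec_nat y (\<lambda>k z. W z k)"
    have Y: "Y 0 = y" "Y (Suc k) = W (Y k) k" for k by (simp_all add: Y_def)
    obtain x where x: "\<And>k. infnorm (x - Y k) \<le> R k"
    proof (rule nested_infnorm_balls[of R Y])
      show "0 \<le> R k" for k using R(1)[of k] by simp
      show "infnorm (Y (Suc k) - Y k) + R (Suc k) \<le> R k" for k
        using R(1)[of k] by (simp add: Y R(2) W(1))
    qed blast
    have "min (\<rho> / 4) (\<kappa> / 32 / real q powr (1 + 1 / CARD('n))) \<le> infnorm (x - rat_point p q)"
      if q: "q \<ge> 1" for p q
    proof -
      define u where "u = real q powr (1 + 1 / CARD('n))"
      have u: "u > 0" using q by (simp add: u_def)
      define P where "P k \<longleftrightarrow> 2 * R k * u \<le> \<kappa>" for k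
      \<comment> \<open>Rational points outside the doubled cube are harmless, since
        \<open>x\<close> is within \<open>R k\<close> of its centre.\<close>
      have lower: "R k / 4 \<le> infnorm (x - rat_point p q)" if "P k" for k
      proof (cases "infnorm (rat_point p q - Y k) \<le> 2 * R k")
        case True
        have "R k / 2 \<le> infnorm (Y (Suc k) - rat_point p q)"
          using W(2)[OF q _ True] that by (simp add: Y P_def u_def)
        moreover have "infnorm (Y (Suc k) - x) \<le> R k / 4"
          using x[of "Suc k"] R(2)[of k] by (simp add: infnorm_sub)
        ultimately show ?thesis
          using infnorm_diff_triangle_ineq[of "Y (Suc k)" "rat_point p q" x] by linarith
      next
        case False
        then show ?thesis
          using infnorm_diff_triangle_ineq[of "rat_point p q" "Y k" x] x[of k] R(1)[of k]
            infnorm_sub[of x "rat_point p q"] by linarith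
      qed
      have "\<exists>k. P k"
      proof -
        obtain k where "(1 / 4) ^ k < \<kappa> / (2 * \<rho> * u)"
          using real_arch_pow_inv[of "\<kappa> / (2 * \<rho> * u)" "1 / 4"] \<kappa> \<rho> u by auto
        then have "P k" using \<rho> u by (simp add: P_def R_def field_simps)
        then show ?thesis ..
      qed
      \<comment> \<open>At the first stage that handles \<open>q\<close>, the failure of the
        preceding stage bounds \<open>R k\<close> from below by a multiple of
        \<open>\<kappa> / u\<close>; if this is stage 0, the cap applies.\<close>
      then obtain k where k: "P k" "\<And>j. j < k \<Longrightarrow> \<not> P j"
        using exists_least_iff[of P] by blast
      show ?thesis
      proof (cases k)
        case 0
        then show ?thesis using lower[OF k(1)] by (simp add: R_def)
      next
        case (Suc j)
        then have "\<kappa> < 2 * R j * u" using k(2)[of j] by (simp add: P_def)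
        then have "\<kappa> / 32 / u \<le> R k / 4" using u by (simp add: Suc R(2) field_simps)
        then show ?thesis using lower[OF k(1)] by (simp add: u_def)
      qed
    qed
    then show ?thesis using x[of 0] by (auto simp: Y R_def)
  qed
  then show ?thesis using \<kappa> by (intro that[of "\<kappa> / 32"]) auto
qed

section \<open>Best approximations\<close>

text \<open>The library's simultaneous Dirichlet theorem with \<open>1 / N < \<tau>\<close>, its
  numerical indices transported to the type \<open>'n\<close> by \<open>h\<close>.\<close>

lemma Dirichlet_approx_vec:
  fixes x :: "real ^ 'n"
  assumes "\<tau> > 0"
  obtains q :: nat and p :: "int ^ 'n"
  where "q \<ge> 1" "infnorm (real q *\<^sub>R x - (\<chi> i. of_int (p $ i))) < \<tau>"
proof -
  obtain N :: nat where N: "N > 0" "1 / real N < \<tau>"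
    using real_arch_invD[OF assms] by (auto simp: inverse_eq_divide)
  obtain h :: "'n \<Rightarrow> nat" where h: "bij_betw h UNIV {0..<CARD('n)}"
    using ex_bij_betw_finite_nat[of "UNIV :: 'n set"] by auto
  obtain q p where qp: "0 < q"
    "\<And>k. k < CARD('n) \<Longrightarrow> \<bar>of_int q * (x $ (inv h k)) - of_int (p k)\<bar> < 1 / real N"
    using Dirichlet_approx_simult[OF N(1), of "CARD('n)" "\<lambda>k. x $ (inv h k)"] by metis
  have "h i < CARD('n)" "inv h (h i) = i" for i
    using h by (auto simp: bij_betw_def)
  then have "\<bar>of_int q * (x $ i) - of_int (p (h i))\<bar> < \<tau>" for i
    using qp(2)[of "h i"] N(2) by simp
  then have "infnorm (real (nat q) *\<^sub>R x - (\<chi> i. of_int ((\<chi> i. p (h i)) $ i))) < \<tau>"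
    using qp(1) by (simp add: infnorm_less_iff_cart)
  then show ?thesis using qp(1) by (intro that[of "nat q" "\<chi> i. p (h i)"]) auto
qed

text \<open>
  The point \<open>p/q\<close> is a best approximation of the badly approximable \<open>x\<close>. For \<open>q' \<le> q/2\<close> minimality
  of \<open>\<parallel>q x - p\<parallel>\<close> lets the separation from \<open>x\<close> pass to \<open>p/q\<close>; the reflection
  \<open>(p', q') \<mapsto> (p - p', q - q')\<close> reduces the other denominators to these.
\<close>

lemma best_approximation_separated:
  fixes x :: "real ^ 'n"
  assumes c: "c > 0"
    and bad: "\<And>p q. q \<ge> 1 \<Longrightarrow> c / real q powr (1 + 1 / CARD('n)) \<le> infnorm (x - rat_point p q)"
    and \<delta>: "\<delta> > 0"
  obtains p q where "q \<ge> M" "q \<ge> 1" "infnorm (x - rat_point p q) < \<delta>"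
    "\<And>p' q'. \<lbrakk>1 \<le> q'; q' < q\<rbrakk> \<Longrightarrow>
      c / 2 / real q' powr (1 + 1 / CARD('n)) \<le> infnorm (rat_point p q - rat_point p' q')"
proof -
  define a where "a = 1 / real CARD('n)"
  have a: "a > 0" by (simp add: a_def)
  define L where "L q p = infnorm (real q *\<^sub>R x - (\<chi> i. of_int (p $ i)))" for q and p :: "int ^ 'n"
  have L_eq: "infnorm (x - rat_point p q) = L q p / real q" if "q \<ge> 1" for p q
    using infnorm_diff_rat_point[OF that] by (simp add: L_def)
  have L_bad: "c / real q powr a \<le> L q p" if "q \<ge> 1" for p q
  proof -
    have "real q powr (1 + 1 / CARD('n)) = real q * real q powr a"
      using that by (simp add: powr_add a_def)
    then show ?thesis
      using bad[OF that, of p] that by (simp add: L_eq[OF that] divide_le_eq)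
  qed
  \<comment> \<open>The second bound rules out \<open>q < M\<close>, because there
    \<open>L q p\<close> is too large by \<open>L_bad\<close>; \<open>Suc\<close> keeps the bound
    positive for \<open>M = 0\<close>.\<close>
  define \<tau> where "\<tau> = min \<delta> (c / real (Suc M) powr a)"
  have \<tau>: "\<tau> > 0" using c \<delta> by (simp add: \<tau>_def)
  define G where "G q \<longleftrightarrow> q \<ge> 1 \<and> (\<exists>p. L q p < \<tau>)" for q
  have "\<exists>q. G q" using Dirichlet_approx_vec[OF \<tau>, of x] unfolding G_def L_def by metis
  \<comment> \<open>The least denominator with an error below \<open>\<tau>\<close> gives a best
    approximation: all smaller ones have error at least \<open>\<tau>\<close>.\<close>
  then obtain q where q: "G q" "\<And>q'. q' < q \<Longrightarrow> \<not> G q'"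
    using exists_least_iff[of G] by blast
  then obtain p where p: "L q p < \<tau>" and q1: "q \<ge> 1" by (auto simp: G_def)
  have minimal: "L q p \<le> L q' p'" if "1 \<le> q'" "q' < q" for q' p'
    proof -
    have "\<not> L q' p' < \<tau>" using q(2)[of q'] that by (auto simp: G_def)
    then show ?thesis using p by linarith
  qed
  have "q \<ge> M"
  proof (rule ccontr)
    assume "\<not> q \<ge> M"
    then have "c / real (Suc M) powr a \<le> c / real q powr a"
      using q1 a c by (intro divide_left_mono powr_mono2 mult_pos_pos) auto
    then show False using L_bad[OF q1, of p] p by (simp add: \<tau>_def)
  qed
  moreover have "infnorm (x - rat_point p q) < \<delta>"
  proof -
    have "L q p / real q \<le> L q p" using q1 divide_left_mono[of 1 "real q" "L q p"] by (simp add: L_def infnorm_pos_le)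
    then show ?thesis using p by (simp add: L_eq[OF q1] \<tau>_def)
  qed
  moreover have "c / 2 / real q' powr (1 + 1 / CARD('n)) \<le> infnorm (rat_point p q - rat_point p' q')"
    if q': "1 \<le> q'" "q' < q" for p' q'
  proof -
    define D where "D q' p' = infnorm (real q' *\<^sub>R rat_point p q - (\<chi> i. of_int (p' $ i)))" for q' and p' :: "int ^ 'n"
    have small: "c / 2 / real s powr a \<le> D s b" if s: "1 \<le> s" "2 * s \<le> q" for s b
    proof -
      have "s < q" using s by simp
      have "L s b \<le> real s * infnorm (x - rat_point p q) + D s b"
        using infnorm_diff_triangle_ineq[of "real s *\<^sub>R x" "\<chi> i. of_int (b $ i)" "real s *\<^sub>R rat_point p q"]
        by (simp add: L_def D_def infnorm_mul flip: scaleR_diff_right)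
      also have "real s * infnorm (x - rat_point p q) = (real s / real q) * L q p"
        by (simp add: L_eq[OF q1])
      also have "\<dots> \<le> (1 / 2) * L s b"
        using s minimal[OF s(1) \<open>s < q\<close>, of b]
        by (intro mult_mono) (auto simp: L_def infnorm_pos_le field_simps)
      finally show ?thesis using L_bad[OF s(1), of b] by simp
    qed
    have "c / 2 / real q' powr a \<le> D q' p'"
    proof (cases "2 * q' \<le> q")
      case True
      then show ?thesis using small q' by blast
    next
      case False
      define s where "s = q - q'"
      have s: "1 \<le> s" "2 * s \<le> q" "s \<le> q'" using False q' by (auto simp: s_def)
      have "real s *\<^sub>R rat_point p q - (\<chi> i. of_int ((p - p') $ i))
          = - (real q' *\<^sub>R rat_point p q - (\<chi> i. of_int (p' $ i)))"
        using q' by (auto simp: vec_eq_iff rat_point_def s_def of_nat_diff field_simps)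
      then have "D s (p - p') = D q' p'" by (metis D_def infnorm_neg)
      moreover have "c / 2 / real q' powr a \<le> c / 2 / real s powr a"
        using s a c by (intro divide_left_mono powr_mono2 mult_pos_pos) auto
      ultimately show ?thesis using small[OF s(1,2), of "p - p'"] by simp
    qed
    moreover have "infnorm (rat_point p q - rat_point p' q') = D q' p' / real q'"
      using infnorm_diff_rat_point[OF q'(1)] by (simp add: D_def)
    moreover have "c / 2 / real q' powr (1 + 1 / CARD('n)) = c / 2 / real q' powr a / real q'"
      using q' by (simp add: powr_add a_def)
    ultimately show ?thesis by (simp only: divide_right_mono of_nat_0_le_iff)
  qed
  ultimately show ?thesis using that q1 by blast
qed

section \<open>The inductive step\<close>

text \<open>The order of quantifiers matters: \<open>N\<close> does not depend on
  \<open>\<eta>\<close>, so the main proof can fix the next threshold first and then shrink the cube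
  according to it.\<close>

lemma exact_step:
  fixes \<psi> :: "nat \<Rightarrow> real" and x0 :: "real ^ 'n"
  assumes pos: "\<And>q. q \<ge> 1 \<Longrightarrow> \<psi> q > 0"
    and anti: "\<And>q q'. \<lbrakk>1 \<le> q; q \<le> q'\<rbrakk> \<Longrightarrow> \<psi> q' \<le> \<psi> q"
    and lim: "(\<lambda>q. real q powr (1 + 1 / CARD('n)) * \<psi> q) \<longlonglongrightarrow> 0"
    and lim': "\<psi> \<longlonglongrightarrow> 0"
    and bad: "badly_approximable x0"
    and \<epsilon>: "0 < \<epsilon>" "\<epsilon> < 1"
  shows "\<forall>\<^sub>F N in sequentially. \<forall>\<eta>>0. \<exists>x1. badly_approximable x1 \<and> infnorm (x1 - x0) < \<eta> \<and>
    (\<exists>p q. N \<le> q \<and> infnorm (x1 - rat_point p q) < \<psi> q) \<and>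
    (\<forall>p' q'. N \<le> q' \<longrightarrow> (1 - \<epsilon>) * \<psi> q' \<le> infnorm (x1 - rat_point p' q'))"
proof -
  define e where "e = 1 + 1 / real CARD('n)"
  obtain c0 where c0: "c0 > 0" "\<And>p q. q \<ge> 1 \<Longrightarrow> c0 / real q powr e \<le> infnorm (x0 - rat_point p q)"
    using bad unfolding badly_approximable_def e_def by blast
  obtain \<kappa> :: real where \<kappa>: "\<kappa> > 0"
    and vertex: "\<And>y \<rho> t. \<lbrakk>\<rho> > 0; t \<ge> 0\<rbrakk> \<Longrightarrow> \<exists>w :: real ^ 'n. infnorm (w - y) = t \<and>
      (\<forall>p q. q \<ge> 1 \<longrightarrow> \<rho> * real q powr e \<le> \<kappa> \<longrightarrow>
        infnorm (rat_point p q - y) \<le> \<rho> \<longrightarrow> t \<le> infnorm (w - rat_point p q))"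
    using vertex_away_from_rationals[where 'n = 'n] unfolding e_def by blast
  obtain c where c: "c > 0"
    and ball: "\<And>y \<rho>. \<rho> > 0 \<Longrightarrow> \<exists>x :: real ^ 'n. infnorm (x - y) \<le> \<rho> \<and>
      (\<forall>p q. q \<ge> 1 \<longrightarrow> min (\<rho> / 4) (c / real q powr e) \<le> infnorm (x - rat_point p q))"
    using badly_approximable_in_ball[where 'n = 'n] unfolding e_def by blast
  \<comment> \<open>The bound \<open>c0 / 8\<close> is for denominators \<open>q' < q\<close>. The
    other two are for those beyond the reach of the vertex, where
    \<open>\<delta> / real q' powr e\<close> has to stay below both terms of the minimum supplied by
    \<open>ball\<close>.\<close>
  define \<delta> where "\<delta> = min (c0 / 8) (min c (\<kappa> * \<epsilon> / 32))"
  have \<delta>: "\<delta> > 0" using c0 c \<kappa> \<epsilon> by (simp add: \<delta>_def)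
  obtain N0 where N0: "\<And>q. q \<ge> N0 \<Longrightarrow> real q powr e * \<psi> q < \<delta>"
    using order_tendstoD(2)[OF lim \<delta>] unfolding eventually_sequentially e_def by blast
  have "\<exists>x1. badly_approximable x1 \<and> infnorm (x1 - x0) < \<eta> \<and>
      (\<exists>p q. N \<le> q \<and> infnorm (x1 - rat_point p q) < \<psi> q) \<and>
      (\<forall>p' q'. N \<le> q' \<longrightarrow> (1 - \<epsilon>) * \<psi> q' \<le> infnorm (x1 - rat_point p' q'))"
    if N: "N \<ge> max 1 N0" and \<eta>: "\<eta> > 0" for N \<eta>
  proof -
    have \<psi>_le: "\<psi> q \<le> \<delta> / real q powr e" if "q \<ge> N" for q
      using N0[of q] that N by (simp add: field_simps)
    \<comment> \<open>This makes \<open>s\<close> smaller than \<open>\<eta> / 2\<close>, so that a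
      point within \<open>s\<close> of \<open>r\<close> is still close to \<open>x0\<close>.\<close>
    obtain M where M: "\<And>q. q \<ge> M \<Longrightarrow> \<psi> q < \<eta> / 2"
      using order_tendstoD(2)[OF lim', of "\<eta> / 2"] \<eta> unfolding eventually_sequentially by auto
    obtain p q where q: "q \<ge> max M N" "q \<ge> 1"
      and near: "infnorm (x0 - rat_point p q) < \<eta> / 2"
      and sep: "\<And>p' q'. \<lbrakk>1 \<le> q'; q' < q\<rbrakk> \<Longrightarrow>
        c0 / 2 / real q' powr e \<le> infnorm (rat_point p q - rat_point p' q')"
      by (rule best_approximation_separated[of c0 x0 "\<eta> / 2" "max M N", folded e_def])
        (use c0 half_gt_zero[OF \<eta>] in blast)+
    define r where "r = rat_point p q"
    define s where "s = \<psi> q"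
    have s: "s > 0" using pos q by (simp add: s_def)
    have es: "0 < \<epsilon> * s" "\<epsilon> * s < s" using \<epsilon> s by auto
    obtain w where w: "infnorm (w - r) = (1 - \<epsilon> / 2) * s"
      "\<And>p' q'. \<lbrakk>q' \<ge> 1; 2 * s * real q' powr e \<le> \<kappa>; infnorm (rat_point p' q' - r) \<le> 2 * s\<rbrakk>
        \<Longrightarrow> (1 - \<epsilon> / 2) * s \<le> infnorm (w - rat_point p' q')"
      using vertex[of "2 * s" "(1 - \<epsilon> / 2) * s" r] s \<epsilon> by auto
    \<comment> \<open>The radius splits the slack: \<open>x1\<close> is at most
      \<open>(1 - \<epsilon> / 4) * s < s\<close> from \<open>r\<close>, and at least
      \<open>(1 - 3 * \<epsilon> / 4) * s\<close> from the rational points that \<open>w\<close>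
      avoids.\<close>
    obtain x1 where x1: "infnorm (x1 - w) \<le> \<epsilon> * s / 4"
      "\<And>p' q'. q' \<ge> 1 \<Longrightarrow> min (\<epsilon> * s / 16) (c / real q' powr e) \<le> infnorm (x1 - rat_point p' q')"
      using ball[of "\<epsilon> * s / 4" w] es(1) by auto
    have "badly_approximable x1"
      using x1(2) es(1) c unfolding e_def by (intro badly_approximableI[of "\<epsilon> * s / 16" c]) auto
    moreover have x1_r: "infnorm (x1 - r) < s"
    proof -
      have "infnorm (x1 - r) \<le> \<epsilon> * s / 4 + (1 - \<epsilon> / 2) * s"
        using infnorm_diff_triangle_ineq[of x1 r w] x1(1) w(1) by linarith
      then show ?thesis using es by (simp add: algebra_simps)
    qed
    moreover have "infnorm (x1 - x0) < \<eta>"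
      using infnorm_diff_triangle_ineq[of x1 x0 r] x1_r near M[of q] q infnorm_sub[of x0 r]
      unfolding r_def s_def by simp
    moreover have "(1 - \<epsilon>) * \<psi> q' \<le> infnorm (x1 - rat_point p' q')" if q': "N \<le> q'" for p' q'
    proof -
      let ?r' = "rat_point p' q'"
      have q'1: "q' \<ge> 1" using q' N by simp
      have u: "real q' powr e > 0" using q'1 by simp
      have le: "(1 - \<epsilon>) * \<psi> q' \<le> \<psi> q'" using \<epsilon> pos[OF q'1] by simp
      show ?thesis
      proof (cases "q' < q")
        \<comment> \<open>Smaller denominators: \<open>?r'\<close> is at least
          \<open>4 * \<psi> q'\<close> from \<open>r\<close>, and \<open>x1\<close> is within
          \<open>s \<le> \<psi> q'\<close> of \<open>r\<close>.\<close>
        case True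
        have "4 * \<psi> q' \<le> 4 * (\<delta> / real q' powr e)" using \<psi>_le[OF q'] by simp
        also have "\<dots> \<le> c0 / 2 / real q' powr e"
          using u by (simp add: \<delta>_def field_simps)
        also have "\<dots> \<le> infnorm (r - ?r')" using sep[OF q'1 True] by (simp add: r_def)
        also have "\<dots> \<le> infnorm (x1 - r) + infnorm (x1 - ?r')"
          using infnorm_diff_triangle_ineq[of r ?r' x1] infnorm_sub[of r x1] by simp
        finally have "4 * \<psi> q' \<le> s + infnorm (x1 - ?r')" using x1_r by simp
        moreover have "s \<le> \<psi> q'" using anti[of q' q] True q'1 by (simp add: s_def)
        ultimately show ?thesis using le pos[OF q'1] by linarith
      next
        case False
        then have s_ge: "\<psi> q' \<le> s" using anti[of q q'] q by (simp add: s_def)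
        show ?thesis
        proof (cases "2 * s * real q' powr e \<le> \<kappa>")
          case True
          show ?thesis
          proof (cases "infnorm (?r' - r) \<le> 2 * s")
            case near': True
            have "(1 - \<epsilon> / 2) * s \<le> \<epsilon> * s / 4 + infnorm (x1 - ?r')"
              using w(2)[OF q'1 True near'] infnorm_diff_triangle_ineq[of w ?r' x1] x1(1) infnorm_sub[of x1 w]
              by linarith
            then have "(1 - \<epsilon>) * s \<le> infnorm (x1 - ?r')" using es by (simp add: algebra_simps)
            moreover have "(1 - \<epsilon>) * \<psi> q' \<le> (1 - \<epsilon>) * s" using s_ge \<epsilon> by (intro mult_left_mono) auto
            ultimately show ?thesis by simp
          next
            \<comment> \<open>Now \<open>?r'\<close> is more than \<open>2 * s\<close> from
              \<open>r\<close>, hence more than \<open>s\<close> from \<open>x1\<close>.\<close>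
            case False
            then show ?thesis
              using infnorm_diff_triangle_ineq[of ?r' r x1] x1_r infnorm_sub[of x1 ?r'] s_ge le by linarith
          qed
        next
          \<comment> \<open>Large denominators: as \<open>s\<close> exceeds
            \<open>\<kappa> / (2 * real q' powr e)\<close>, both terms of the minimum in
            \<open>x1\<close> are at least \<open>\<delta> / real q' powr e\<close>, which bounds
            \<open>\<psi> q'\<close>.\<close>
          case False
          then have "\<kappa> * \<epsilon> / 32 \<le> \<epsilon> * s / 16 * real q' powr e"
            using mult_right_mono[of \<kappa> "2 * s * real q' powr e" "\<epsilon> / 32"] \<epsilon> by (simp add: mult_ac)
          moreover have "\<delta> \<le> \<kappa> * \<epsilon> / 32" by (simp add: \<delta>_def)
          ultimately have "\<delta> \<le> \<epsilon> * s / 16 * real q' powr e" by linarith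
          then have "\<delta> / real q' powr e \<le> \<epsilon> * s / 16" using u by (simp only: pos_divide_le_eq)
          moreover have "\<delta> / real q' powr e \<le> c / real q' powr e"
            by (intro divide_right_mono) (auto simp: \<delta>_def)
          ultimately show ?thesis using x1(2)[OF q'1, of p'] \<psi>_le[OF q'] le by linarith
        qed
      qed
    qed
    ultimately show ?thesis using q unfolding r_def s_def
      by (intro exI[of _ x1]) auto
  qed
  then show ?thesis unfolding eventually_sequentially by blast
qed

section \<open>A criterion for exactness in terms of denominators\<close>

text \<open>Approximability counts points, the hypotheses speak of denominators. Finitely many
  points cannot serve arbitrarily large \<open>q\<close>, since their distances from
  \<open>x\<close> are positive and \<open>\<psi>\<close> tends to 0; conversely, bounded
  denominators admit only finitely many points near \<open>x\<close>.\<close>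

lemma exact_approximableI:
  fixes \<psi> :: "nat \<Rightarrow> real" and x :: "real ^ 'n"
  assumes pos: "\<And>q. q \<ge> 1 \<Longrightarrow> \<psi> q > 0"
    and anti: "\<And>q q'. \<lbrakk>1 \<le> q; q \<le> q'\<rbrakk> \<Longrightarrow> \<psi> q' \<le> \<psi> q"
    and lim: "\<psi> \<longlonglongrightarrow> 0"
    and upper: "\<And>N. \<exists>q\<ge>N. \<exists>p. infnorm (x - rat_point p q) < \<psi> q"
    and lower: "\<And>c. c < 1 \<Longrightarrow> \<forall>\<^sub>F q in sequentially. \<forall>p. c * \<psi> q \<le> infnorm (x - rat_point p q)"
  shows "x \<in> exact_approximable \<psi>"
proof -
  have irrational: "infnorm (x - rat_point p q) > 0" if q: "q \<ge> 1" for p q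
  proof -
    obtain N where N: "\<And>q p. q \<ge> N \<Longrightarrow> 1 / 2 * \<psi> q \<le> infnorm (x - rat_point p q)"
      using lower[of "1 / 2"] unfolding eventually_sequentially by auto
    \<comment> \<open>A rational point has representations with arbitrarily large denominators, to
      which the lower bound applies.\<close>
    have "rat_point (\<chi> i. int (Suc N) * p $ i) (Suc N * q) = rat_point p q"
      using q by (simp add: rat_point_def vec_eq_iff del: of_nat_Suc mult_Suc)
    moreover have "Suc N * q \<ge> N" "Suc N * q \<ge> 1" using q by (auto simp: Suc_le_eq trans_le_add2)
    ultimately show ?thesis
      using N[of "Suc N * q" "\<chi> i. int (Suc N) * p $ i"] pos[of "Suc N * q"] by auto
  qed
  have "x \<in> approximable \<psi>"
    unfolding approximable_def
  proof (intro CollectI notI)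
    let ?S = "{r. \<exists>p q. q \<ge> 1 \<and> r = rat_point p q \<and> infnorm (x - r) < \<psi> q}"
    assume fin: "finite ?S"
    \<comment> \<open>Inserting 1 keeps the minimum meaningful for an empty set.\<close>
    define d where "d = Min (insert 1 ((\<lambda>r. infnorm (x - r)) ` ?S))"
    have "d > 0" using fin irrational by (auto simp: d_def)
    then obtain N where N: "\<And>q. q \<ge> N \<Longrightarrow> \<psi> q < d"
      using order_tendstoD(2)[OF lim] unfolding eventually_sequentially by blast
    obtain q p where q: "q \<ge> max N 1" "infnorm (x - rat_point p q) < \<psi> q"
      using upper[of "max N 1"] by blast
    then have "rat_point p q \<in> ?S" by auto
    then have "d \<le> infnorm (x - rat_point p q)" using fin by (auto simp: d_def)
    then show False using N[of q] q by simp
  qed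
  moreover have "x \<notin> approximable (\<lambda>q. c * \<psi> q)" if c: "0 < c" "c < 1" for c
  proof -
    obtain N where N: "\<And>q p. q \<ge> N \<Longrightarrow> c * \<psi> q \<le> infnorm (x - rat_point p q)"
      using lower[OF c(2)] unfolding eventually_sequentially by auto
    \<comment> \<open>Points that violate the lower bound have \<open>q < N\<close> and lie within
      \<open>\<psi> 1\<close> of \<open>x\<close>, so \<open>B\<close> bounds their
      numerators.\<close>
    define B where "B = real N * (infnorm x + \<psi> 1)"
    define P :: "(int ^ 'n) set" where "P = {p. \<forall>i. \<bar>real_of_int (p $ i)\<bar> \<le> B}"
    have "finite P"
    proof (rule finite_subset)
      show "P \<subseteq> vec_lambda ` PiE UNIV (\<lambda>_. {- \<lfloor>B\<rfloor>..\<lfloor>B\<rfloor>})"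
      proof
        fix p assume "p \<in> P"
        then have "p $ i \<in> {- \<lfloor>B\<rfloor>..\<lfloor>B\<rfloor>}" for i
          using le_floor_iff[of "p $ i" B] le_floor_iff[of "- (p $ i)" B]
          unfolding P_def by (simp add: abs_le_iff minus_le_iff)
        then show "p \<in> vec_lambda ` PiE UNIV (\<lambda>_. {- \<lfloor>B\<rfloor>..\<lfloor>B\<rfloor>})"
          by (intro image_eqI[of _ _ "vec_nth p"]) auto
      qed
    qed (simp add: finite_PiE)
    moreover have "{r. \<exists>p q. q \<ge> 1 \<and> r = rat_point p q \<and> infnorm (x - r) < c * \<psi> q}
        \<subseteq> (\<lambda>(p, q). rat_point p q) ` (P \<times> {..<N})"
    proof clarify
      fix p :: "int ^ 'n" and q :: nat
      assume q: "1 \<le> q" and less: "infnorm (x - rat_point p q) < c * \<psi> q"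
      have "q < N" using N[of q p] less by (meson linorder_not_le)
      have "c * \<psi> q \<le> \<psi> 1"
        using mult_mono[of c 1 "\<psi> q" "\<psi> 1"] c anti[of 1 q] q pos[of q] by simp
      then have "infnorm (rat_point p q) \<le> infnorm x + \<psi> 1"
        using less infnorm_diff_triangle_ineq[of "rat_point p q" 0 x] infnorm_sub[of x "rat_point p q"] by simp
      then have "\<bar>real_of_int (p $ i)\<bar> / real q \<le> infnorm x + \<psi> 1" for i
        using component_le_infnorm_cart[of "rat_point p q" i] by (simp add: rat_point_def)
      then have "\<bar>real_of_int (p $ i)\<bar> \<le> real q * (infnorm x + \<psi> 1)" for i
        using q by (simp add: field_simps)
      moreover have "real q * (infnorm x + \<psi> 1) \<le> B"
        using \<open>q < N\<close> pos[of 1] infnorm_pos_le[of x] unfolding B_def by (intro mult_right_mono) auto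
      ultimately have "p \<in> P" unfolding P_def by (auto intro: order_trans)
      with \<open>q < N\<close> show "rat_point p q \<in> (\<lambda>(p, q). rat_point p q) ` (P \<times> {..<N})" by force
    qed
    ultimately show ?thesis
      unfolding approximable_def using finite_subset by blast
  qed
  ultimately show ?thesis unfolding exact_approximable_def by auto
qed

section \<open>The limit of the construction\<close>

theorem theorem2:
  fixes \<psi> :: "nat \<Rightarrow> real"
  assumes "\<And>q. q \<ge> 1 \<Longrightarrow> \<psi> q > 0"
    and "antimono_on {1..} \<psi>"
    and "(\<lambda>s. real s powr ((real CARD('n) + 1) / real CARD('n)) * \<psi> s) \<longlonglongrightarrow> 0"
  shows "(exact_approximable \<psi> :: (real ^ 'n) set) \<noteq> {}"
proof -
  note pos = assms(1)
  have anti: "\<psi> q' \<le> \<psi> q" if "1 \<le> q" "q \<le> q'" for q q'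
    using monotone_onD[OF assms(2), of q q'] that by simp
  have exponent: "(real CARD('n) + 1) / real CARD('n) = 1 + 1 / CARD('n)"
    by (simp add: add_divide_distrib)
  note lim = assms(3)[unfolded exponent]
  have lim': "\<psi> \<longlonglongrightarrow> 0"
  proof (rule tendsto_sandwich[OF _ _ tendsto_const lim])
    show "\<forall>\<^sub>F q in sequentially. 0 \<le> \<psi> q"
      using eventually_ge_at_top[of 1] by eventually_elim (use pos in \<open>auto intro: less_imp_le\<close>)
    show "\<forall>\<^sub>F q in sequentially. \<psi> q \<le> real q powr (1 + 1 / CARD('n)) * \<psi> q"
      using eventually_ge_at_top[of 1]
    proof eventually_elim
      case (elim q)
      then have "1 \<le> real q powr (1 + 1 / CARD('n))" by (intro ge_one_powr_ge_zero) auto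
      then show ?case using pos[OF elim] by (simp add: mult_le_cancel_right1)
    qed
  qed
  \<comment> \<open>A null sequence; the shift by 2 ensures \<open>\<epsilon> 0 < 1\<close>.\<close>
  define \<epsilon> where "\<epsilon> k = 1 / (real k + 2)" for k
  have \<epsilon>: "0 < \<epsilon> k" "\<epsilon> k < 1" for k by (simp_all add: \<epsilon>_def)
  define step where "step k N x0 \<eta> x1 \<longleftrightarrow> badly_approximable x1 \<and> infnorm (x1 - x0) < \<eta> \<and>
    (\<exists>p q. N \<le> q \<and> infnorm (x1 - rat_point p q) < \<psi> q) \<and>
    (\<forall>p q. N \<le> q \<longrightarrow> (1 - \<epsilon> k) * \<psi> q \<le> infnorm (x1 - rat_point p q))"
    for k N \<eta> and x0 x1 :: "real ^ 'n"
  have step_ex: "\<exists>N>M. \<forall>\<eta>>0. \<exists>x1. step k N x0 \<eta> x1"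
    if "badly_approximable x0" for x0 :: "real ^ 'n" and k M
  proof -
    have "\<forall>\<^sub>F N in sequentially. \<forall>\<eta>>0. \<exists>x1. step k N x0 \<eta> x1"
      unfolding step_def by (rule exact_step) (use pos anti lim lim' that \<epsilon>[of k] in auto)
    then obtain N0 where "\<And>N. N \<ge> N0 \<Longrightarrow> \<forall>\<eta>>0. \<exists>x1. step k N x0 \<eta> x1"
      unfolding eventually_sequentially by blast
    then show ?thesis by (intro exI[of _ "Suc (max M N0)"]) auto
  qed
  \<comment> \<open>A state consists of the centre and radius of a cube and a threshold that already
    suits the next step, however small its \<open>\<eta>\<close>.\<close>
  define invar where "invar k = (\<lambda>(x0, \<eta> :: real, N). 0 < \<eta> \<and> 1 \<le> N \<and> (\<forall>\<eta>>0. \<exists>x1. step k N x0 \<eta> x1))"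
    for k :: nat
  \<comment> \<open>The conditions hold on the whole new cube and hence at the limit. The lower
    bound is confined to the finitely many denominators in a window, so that it survives a small
    perturbation; later stages treat the rest.\<close>
  define next_ball where "next_ball k = (\<lambda>(x0, \<eta>, N) (x1 :: real ^ 'n, \<eta>' :: real, N'). infnorm (x1 - x0) + \<eta>' \<le> \<eta> \<and> N < N' \<and>
    (\<forall>z. infnorm (z - x1) \<le> \<eta>' \<longrightarrow>
      (\<exists>p q. N \<le> q \<and> infnorm (z - rat_point p q) < \<psi> q) \<and>
      (\<forall>p q. N \<le> q \<longrightarrow> q < N' \<longrightarrow> (1 - 2 * \<epsilon> k) * \<psi> q \<le> infnorm (z - rat_point p q))))"
    for k :: nat
  have "\<exists>f. \<forall>k. invar k (f k) \<and> next_ball k (f k) (f (Suc k))"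
  proof (rule dependent_nat_choice)
    obtain c :: real and x :: "real ^ 'n" where "c > 0"
      "\<And>p q. q \<ge> 1 \<Longrightarrow> min (1 / 4) (c / real q powr (1 + 1 / CARD('n))) \<le> infnorm (x - rat_point p q)"
      using badly_approximable_in_ball[where 'n = 'n] zero_less_one by metis
    then have "badly_approximable x" by (intro badly_approximableI[of "1 / 4" c]) auto
    then obtain N where "N > 0" "\<forall>\<eta>>0. \<exists>x1. step 0 N x \<eta> x1" using step_ex by blast
    then have "invar 0 (x, 1, N)" by (simp add: invar_def)
    then show "\<exists>s. invar 0 s" ..
  next
    fix s k
    assume invar: "invar k s"
    obtain x0 \<eta> N where s: "s = (x0, \<eta>, N)" by (cases s)
    have \<eta>: "\<eta> > 0" "\<eta> / 2 > 0" and N: "N \<ge> 1" using invar by (auto simp: s invar_def)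
    obtain x1 where x1: "step k N x0 (\<eta> / 2) x1" using invar \<eta>(2) unfolding s invar_def prod.case by blast
    obtain p q where q: "N \<le> q" "infnorm (x1 - rat_point p q) < \<psi> q" using x1 by (auto simp: step_def)
    obtain N' where N': "N' > N" "\<forall>\<eta>>0. \<exists>x2. step (Suc k) N' x1 \<eta> x2"
      using step_ex[of x1 N "Suc k"] x1 by (auto simp: step_def)
    \<comment> \<open>The three terms yield nesting, the strict inequality for \<open>p/q\<close>
      throughout the cube, and a loss of at most \<open>\<epsilon> k * \<psi> N'\<close>, which is
      at most \<open>\<epsilon> k * \<psi> a\<close> for all \<open>a\<close> in the window.\<close>
    define \<eta>' where "\<eta>' = min (\<eta> / 2) (min ((\<psi> q - infnorm (x1 - rat_point p q)) / 2) (\<epsilon> k * \<psi> N'))"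
    have "\<eta>' > 0" using \<eta> q \<epsilon>(1)[of k] pos[of N'] N' by (simp add: \<eta>'_def)
    have "invar (Suc k) (x1, \<eta>', N')" using \<open>\<eta>' > 0\<close> N' by (simp add: invar_def)
    moreover have "next_ball k s (x1, \<eta>', N')"
      unfolding next_ball_def s prod.case
    proof (intro conjI allI impI)
      show "infnorm (x1 - x0) + \<eta>' \<le> \<eta>" using x1 by (simp add: step_def \<eta>'_def min_def)
      fix z assume z: "infnorm (z - x1) \<le> \<eta>'"
      have "infnorm (z - rat_point p q) < \<psi> q"
        using infnorm_diff_triangle_ineq[of z "rat_point p q" x1] z q(2) by (simp add: \<eta>'_def)
      then show "\<exists>p q. N \<le> q \<and> infnorm (z - rat_point p q) < \<psi> q" using q(1) by blast
      fix b :: "int ^ 'n" and a :: nat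
      assume a: "N \<le> a" "a < N'"
      have "(1 - \<epsilon> k) * \<psi> a \<le> infnorm (x1 - rat_point b a)" using x1 a(1) by (simp add: step_def)
      also have "\<dots> \<le> \<epsilon> k * \<psi> N' + infnorm (z - rat_point b a)"
        using infnorm_diff_triangle_ineq[of x1 "rat_point b a" z] z infnorm_sub[of x1 z] by (simp add: \<eta>'_def)
      also have "\<epsilon> k * \<psi> N' \<le> \<epsilon> k * \<psi> a"
        using anti[of a N'] a N \<epsilon>(1)[of k] by (intro mult_left_mono) auto
      finally show "(1 - 2 * \<epsilon> k) * \<psi> a \<le> infnorm (z - rat_point b a)" by (simp add: algebra_simps)
    qed (use N' in auto)
    ultimately show "\<exists>s'. invar (Suc k) s' \<and> next_ball k s s'" by blast
  qed
  then obtain f where f: "\<And>k. invar k (f k)" "\<And>k. next_ball k (f k) (f (Suc k))" by blast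
  define X where "X k = fst (f k)" for k
  define R where "R k = fst (snd (f k))" for k
  define N where "N k = snd (snd (f k))" for k
  have f_eq: "f k = (X k, R k, N k)" for k by (simp add: X_def R_def N_def)
  have R: "R k > 0" for k using f(1)[of k] by (simp add: f_eq invar_def)
  note nb = f(2)[unfolded f_eq next_ball_def prod.case]
  obtain x where x: "\<And>k. infnorm (x - X k) \<le> R k"
  proof (rule nested_infnorm_balls[of R X])
    show "0 \<le> R k" for k using R[of k] by simp
    show "infnorm (X (Suc k) - X k) + R (Suc k) \<le> R k" for k using nb[of k] by blast
  qed blast
  have N_mono: "strict_mono N" using nb by (auto simp: strict_mono_Suc_iff)
  have N_ge: "k \<le> N k" for k using N_mono by (rule strict_mono_imp_increasing)
  have "x \<in> exact_approximable \<psi>"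
  proof (rule exact_approximableI[OF pos anti lim'])
    show "\<exists>q\<ge>M. \<exists>p. infnorm (x - rat_point p q) < \<psi> q" for M
      using nb[of M] x[of "Suc M"] N_ge[of M] by (meson order_trans)
  next
    fix c :: real
    assume c: "c < 1"
    obtain K :: nat where K: "2 / (1 - c) < real K" using reals_Archimedean2 by blast
    have \<epsilon>_le: "c \<le> 1 - 2 * \<epsilon> k" if "K \<le> k" for k
    proof -
      have "2 / (1 - c) \<le> real k + 2" using K that by linarith
      then have "2 \<le> (1 - c) * (real k + 2)" using c by (simp add: divide_le_eq mult.commute)
      then have "2 / (real k + 2) \<le> 1 - c" by (simp add: divide_le_eq)
      then show ?thesis by (simp add: \<epsilon>_def)
    qed
    have "c * \<psi> q \<le> infnorm (x - rat_point p q)" if q: "N K \<le> q" for p q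
    proof -
      \<comment> \<open>The windows \<open>N k \<le> q < N (Suc k)\<close> cover all
        \<open>q \<ge> N 0\<close>; the least \<open>j\<close> finds the one that contains
        \<open>q\<close>.\<close>
      define j where "j = (LEAST j. q < N j)"
      have "q < N (Suc q)" using N_ge[of "Suc q"] by simp
      then have j: "q < N j" unfolding j_def by (rule LeastI)
      then have "K < j" using q N_mono by (meson le_less_trans strict_mono_less)
      then obtain k where k: "j = Suc k" "K \<le> k" by (cases j) auto
      have "N k \<le> q" using not_less_Least[of k "\<lambda>j. q < N j"] k(1) unfolding j_def by linarith
      then have "(1 - 2 * \<epsilon> k) * \<psi> q \<le> infnorm (x - rat_point p q)"
        using nb[of k] x[of "Suc k"] j k(1) by blast
      moreover have "1 \<le> q" using f(1)[of k] \<open>N k \<le> q\<close> by (simp add: f_eq invar_def)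
      then have "c * \<psi> q \<le> (1 - 2 * \<epsilon> k) * \<psi> q"
        using \<epsilon>_le[OF k(2)] pos[of q] by (intro mult_right_mono) auto
      ultimately show ?thesis by simp
    qed
    then show "\<forall>\<^sub>F q in sequentially. \<forall>p. c * \<psi> q \<le> infnorm (x - rat_point p q)"
      unfolding eventually_sequentially by blast
  qed
  then show ?thesis by blast
qed

end
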